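(* Let $k\ge 1$ be an integer and let $E_k\in\mathbb{Q}[[z_1,\dots,z_k]]$ be the exponential generating function $$E_k=\sum_{i_1,\dots,i_k\ge 0}V(1^{i_1}\cdots k^{i_k})\,\frac{z_1^{i_1}}{i_1!}\cdots\frac{z_k^{i_k}}{i_k!}$$ of the numbers of vertices of Gelfand--Zetlin polytopes. Then $E_k$ satisfies the partial differential equation with constant coefficients $$\left(\frac{\partial^k}{\partial z_1\cdots\partial z_k}-\left(\frac{\partial}{\partial z_1}+\frac{\partial}{\partial z_2}\right)\left(\frac{\partial}{\partial z_2}+\frac{\partial}{\partial z_3}\right)\cdots\left(\frac{\partial}{\partial z_{k-1}}+\frac{\partial}{\partial z_k}\right)\right)E_k=0.$$
   Context: Let $\lambda_1\le\dots\le\lambda_n$ be a non-decreasing finite sequence of integers (called a partition). The Gelfand--Zetlin polytope $GZ(\lambda)$ is the convex polytope in $\mathbb{R}^{n(n-1)/2}$ with coordinates $u_{i,j}$ ($1\le i\le n-1$, $1\le j\le n-i$) defined by the inequalities $u_{i-1,j}\le u_{i,j}\le u_{i-1,j+1}$ for all such $i,j$, where $u_{0,j}:=\lambda_j$. For non-negative integers $i_1,\dots,i_k$ (some possibly zero), $1^{i_1}2^{i_2}\cdots k^{i_k}$ denotes the sequence consisting of $i_1$ copies of $1$, followed by $i_2$ copies of $2$, ..., $i_k$ copies of $k$. $V(p)$ denotes the number of vertices of $GZ(p)$; for the empty sequence $V=1$ (the polytope is a point). For $k=1$ the empty product of operators is the identity. *)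

theory Defs
  imports
    "HOL-Analysis.Polytope"
    "HOL-Analysis.Finite_Function_Topology"
    "HOL-Library.Function_Algebras"
begin

section \<open>Gelfand--Zetlin polytopes\<close>

definition gz_index :: "nat \<Rightarrow> (nat \<times> nat) set" where
  "gz_index n = {(i, j). 1 \<le> i \<and> i \<le> n - 1 \<and> 1 \<le> j \<and> j \<le> n - i}"

text \<open>Row 0 of the Gelfand--Zetlin table is the given sequence, whose entries are counted from 1
  on paper and from 0 in a list.\<close>

definition gz_entry :: "int list \<Rightarrow> (nat \<times> nat \<Rightarrow>\<^sub>0 real) \<Rightarrow> nat \<Rightarrow> nat \<Rightarrow> real" where
  "gz_entry p u i j = (if i = 0 then real_of_int (p ! (j - 1)) else Poly_Mapping.lookup u (i, j))"

text \<open>The dimension depends on the length \<open>n\<close> of the sequence, so the ambient space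
  of dimension \<open>n (n - 1) / 2\<close> is taken as the coordinate subspace, spanned by \<open>gz_index n\<close>, of
  the real vector space of finitely supported families indexed by pairs. All coordinates outside
  \<open>gz_index n\<close> are 0.\<close>

definition GZ :: "int list \<Rightarrow> (nat \<times> nat \<Rightarrow>\<^sub>0 real) set" where
  "GZ p = {u. Poly_Mapping.keys u \<subseteq> gz_index (length p) \<and>
     (\<forall>(i, j) \<in> gz_index (length p).
        gz_entry p u (i - 1) j \<le> gz_entry p u i j \<and>
        gz_entry p u i j \<le> gz_entry p u (i - 1) (j + 1))}"

definition V :: "int list \<Rightarrow> nat" where
  "V p = card {u. u extreme_point_of GZ p}"

definition block_seq :: "nat \<Rightarrow> (nat \<Rightarrow> nat) \<Rightarrow> int list" where
  "block_seq k i = concat (map (\<lambda>j. replicate (i j) (int j)) [1..<k + 1])"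

section \<open>Formal power series and differential operators\<close>

text \<open>A formal power series over the rationals in variables \<open>z\<^sub>0, z\<^sub>1, z\<^sub>2, \<dots>\<close> is given by its
  coefficients; the index is the exponent of the monomial. A series in \<open>z\<^sub>1, \<dots>, z\<^sub>k\<close> is one whose
  coefficients vanish at all exponents that are not supported in \<open>{1..k}\<close>. Sums, differences and
  0, both of series and of operators on them, are pointwise (\<^theory>\<open>HOL-Library.Function_Algebras\<close>).\<close>

type_synonym mfps = "(nat \<Rightarrow>\<^sub>0 nat) \<Rightarrow> rat"

definition pderiv_mfps :: "nat \<Rightarrow> mfps \<Rightarrow> mfps" where
  "pderiv_mfps j f =
     (\<lambda>m. of_nat (Poly_Mapping.lookup m j + 1) * f (m + Poly_Mapping.single j 1))"

definition op_prod :: "(mfps \<Rightarrow> mfps) list \<Rightarrow> mfps \<Rightarrow> mfps" where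
  "op_prod Ds = foldr (\<circ>) Ds id"

definition E :: "nat \<Rightarrow> mfps" where
  "E k = (\<lambda>m. if Poly_Mapping.keys m \<subseteq> {1..k}
     then of_nat (V (block_seq k (Poly_Mapping.lookup m))) /
            (\<Prod>j = 1..k. fact (Poly_Mapping.lookup m j))
     else 0)"

end

theory Submission
  imports Defs
begin

text \<open>A point of \<open>GZ p\<close> is a vertex iff every entry equals one of its two upper neighbours. Removing
  the top row of the triangular table therefore gives \<open>V p = \<Sum> V q\<close>, summed over the possible second
  rows \<open>q\<close>. For a sequence with blocks \<open>1\<close> to \<open>k\<close> of positive size, \<open>q\<close> is determined by the choice,
  for each \<open>j < k\<close>, between \<open>j\<close> and \<open>j + 1\<close> at the boundary of blocks \<open>j\<close> and \<open>j + 1\<close>. Since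
  derivatives of exponential generating functions shift coefficients, this recursion is the
  differential equation.\<close>

section \<open>Extreme points of Gelfand--Zetlin polytopes\<close>

lemma lookup_scaleR [simp]:
  "Poly_Mapping.lookup (r *\<^sub>R x) i = r *\<^sub>R Poly_Mapping.lookup x i"
proof -
  have "finite {i. r *\<^sub>R Poly_Mapping.lookup x i \<noteq> 0}"
    by (rule finite_subset[OF _ finite_lookup[of x]]) auto
  then show ?thesis
    by (simp add: scaleR_poly_mapping_def)
qed

lemma mem_gz_index: "(i, j) \<in> gz_index n \<longleftrightarrow> 1 \<le> i \<and> 1 \<le> j \<and> i + j \<le> n"
  by (auto simp: gz_index_def)

lemma finite_gz_index: "finite (gz_index n)"
  by (rule finite_subset[of _ "{..n} \<times> {..n}"]) (auto simp: mem_gz_index)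

lemma lookup_outside_gz_index:
  "Poly_Mapping.keys u \<subseteq> gz_index n \<Longrightarrow> x \<notin> gz_index n \<Longrightarrow> Poly_Mapping.lookup u x = 0"
  by (meson not_in_keys_iff_lookup_eq_zero subsetD)

lemma keys_GZ: "u \<in> GZ p \<Longrightarrow> Poly_Mapping.keys u \<subseteq> gz_index (length p)"
  by (simp add: GZ_def)

text \<open>Indexing the lower row by \<open>Suc i\<close> removes the truncated subtraction
  \<open>i - 1\<close> and prepares inductions over rows.\<close>

lemma mem_GZ:
  "u \<in> GZ p \<longleftrightarrow> Poly_Mapping.keys u \<subseteq> gz_index (length p) \<and>
     (\<forall>i j. 1 \<le> j \<longrightarrow> Suc i + j \<le> length p \<longrightarrow>
        gz_entry p u i j \<le> gz_entry p u (Suc i) j \<and>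
        gz_entry p u (Suc i) j \<le> gz_entry p u i (Suc j))"
proof -
  have "(\<forall>x\<in>gz_index n. Q x) \<longleftrightarrow> (\<forall>i j. 1 \<le> j \<longrightarrow> Suc i + j \<le> n \<longrightarrow> Q (Suc i, j))" for n Q
  proof (intro iffI ballI allI impI)
    fix x assume Q: "\<forall>i j. 1 \<le> j \<longrightarrow> Suc i + j \<le> n \<longrightarrow> Q (Suc i, j)" and x: "x \<in> gz_index n"
    obtain i j where "x = (Suc i, j)"
      using x by (cases x; cases "fst x") (auto simp: mem_gz_index)
    with Q x show "Q x" by (simp add: mem_gz_index)
  qed (simp add: mem_gz_index)
  then show ?thesis
    by (simp add: GZ_def)
qed

text \<open>The combinatorial description of vertices. The inequalities are left out because for
  sorted \<open>p\<close> they follow, see \<open>gz_tight_mem_GZ\<close>.\<close>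

definition gz_tight :: "int list \<Rightarrow> (nat \<times> nat \<Rightarrow>\<^sub>0 real) \<Rightarrow> bool" where
  "gz_tight p u \<longleftrightarrow> (\<forall>i j. 1 \<le> j \<longrightarrow> Suc i + j \<le> length p \<longrightarrow>
     gz_entry p u (Suc i) j \<in> {gz_entry p u i j, gz_entry p u i (Suc j)})"

text \<open>The entry \<open>(i, j + 1)\<close> separates \<open>(i + 1, j)\<close> from
  \<open>(i + 1, j + 1)\<close>. In \<open>GZ p\<close> this is immediate; for tight points it needs
  monotonicity of row \<open>i\<close>, hence the induction.\<close>

lemma gz_entry_row_mono:
  assumes "sorted p" and u: "u \<in> GZ p \<or> gz_tight p u"
  shows "\<lbrakk>1 \<le> j; Suc i + j \<le> length p\<rbrakk> \<Longrightarrow> gz_entry p u i j \<le> gz_entry p u i (Suc j)"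
proof (induction i arbitrary: j)
  case 0
  then show ?case
    using \<open>sorted p\<close> by (auto simp: gz_entry_def intro!: sorted_nth_mono)
next
  case (Suc i)
  have le: "gz_entry p u i j \<le> gz_entry p u i (Suc j)"
    "gz_entry p u i (Suc j) \<le> gz_entry p u i (Suc (Suc j))"
    using Suc.prems Suc.IH[of j] Suc.IH[of "Suc j"] by simp_all
  from u show ?case
  proof
    assume "u \<in> GZ p"
    then have "gz_entry p u (Suc i) j \<le> gz_entry p u i (Suc j)"
      "gz_entry p u i (Suc j) \<le> gz_entry p u (Suc i) (Suc j)"
      using Suc.prems by (simp_all add: mem_GZ)
    then show ?thesis by linarith
  next
    assume "gz_tight p u"
    then have "gz_entry p u (Suc i) j \<in> {gz_entry p u i j, gz_entry p u i (Suc j)}"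
      "gz_entry p u (Suc i) (Suc j) \<in> {gz_entry p u i (Suc j), gz_entry p u i (Suc (Suc j))}"
      using Suc.prems unfolding gz_tight_def by simp_all
    then show ?thesis using le by auto
  qed
qed

lemma gz_tight_mem_GZ:
  assumes "sorted p" "Poly_Mapping.keys u \<subseteq> gz_index (length p)" "gz_tight p u"
  shows "u \<in> GZ p"
  unfolding mem_GZ
proof (intro conjI allI impI)
  fix i j assume ij: "1 \<le> j" "Suc i + j \<le> length p"
  have *: "gz_entry p u (Suc i) j \<in> {gz_entry p u i j, gz_entry p u i (Suc j)}"
    using assms(3) ij unfolding gz_tight_def by blast
  have "gz_entry p u i j \<le> gz_entry p u i (Suc j)"
    using gz_entry_row_mono[of p u j i] assms ij by blast
  with * show "gz_entry p u i j \<le> gz_entry p u (Suc i) j"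
    "gz_entry p u (Suc i) j \<le> gz_entry p u i (Suc j)" by auto
qed (fact assms)

lemma GZ_eqI:
  assumes "a \<in> GZ p" "b \<in> GZ p" "\<And>i j. gz_entry p a i j = gz_entry p b i j"
  shows "a = b"
proof (rule poly_mapping_eqI)
  fix x :: "nat \<times> nat"
  obtain i j where x: "x = (i, j)" by (cases x)
  \<comment> \<open>\<open>gz_entry\<close> reads row 0 from \<open>p\<close>, so these coordinates
    are compared through the support condition.\<close>
  have "i = 0 \<Longrightarrow> Poly_Mapping.lookup a x = 0 \<and> Poly_Mapping.lookup b x = 0"
    using assms(1,2) by (simp add: x mem_gz_index lookup_outside_gz_index[OF keys_GZ])
  then show "Poly_Mapping.lookup a x = Poly_Mapping.lookup b x"
    using assms(3)[of i j] by (cases "i = 0") (auto simp: gz_entry_def x)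
qed

lemma convex_combination_at_bound:
  fixes a b t :: real
  assumes "0 < t" "t < 1" and "(a \<ge> m \<and> b \<ge> m) \<or> (a \<le> m \<and> b \<le> m)" and "(1 - t) * a + t * b = m"
  shows "a = m \<and> b = m"
proof -
  have eq: "(1 - t) * (a - m) + t * (b - m) = 0"
    using assms(4) by (simp add: algebra_simps)
  from assms(3) show ?thesis
  proof
    assume "a \<ge> m \<and> b \<ge> m"
    then have "0 \<le> (1 - t) * (a - m)" "0 \<le> t * (b - m)" using assms by simp_all
    with eq have "(1 - t) * (a - m) = 0" "t * (b - m) = 0" by linarith+
    with assms show ?thesis by simp
  next
    assume "a \<le> m \<and> b \<le> m"
    then have "(1 - t) * (a - m) \<le> 0" "t * (b - m) \<le> 0" 
      using assms by (simp_all add: mult_nonneg_nonpos)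
    with eq have "(1 - t) * (a - m) = 0" "t * (b - m) = 0" by linarith+
    with assms show ?thesis by simp
  qed
qed

text \<open>Going down the rows, the endpoints of a segment through \<open>u\<close> agree with
  \<open>u\<close>: each entry of \<open>u\<close> equals an upper neighbour, already shared by
  \<open>a\<close> and \<open>b\<close>, which bounds the entries of both from the same side. A
  proper convex combination attains such a bound only if both entries do.\<close>

lemma gz_tight_extreme:
  assumes "u \<in> GZ p" "gz_tight p u"
  shows "u extreme_point_of GZ p"
  unfolding extreme_point_of_def
proof (intro conjI ballI notI)
  fix a b assume a: "a \<in> GZ p" and b: "b \<in> GZ p" and seg: "u \<in> open_segment a b"
  obtain t where t: "0 < t" "t < 1" and ut: "u = (1 - t) *\<^sub>R a + t *\<^sub>R b" and "a \<noteq> b"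
    using seg by (auto simp: in_segment)
  have "gz_entry p a i j = gz_entry p u i j \<and> gz_entry p b i j = gz_entry p u i j" for i j
  proof (induction i arbitrary: j)
    case 0
    then show ?case by (simp add: gz_entry_def)
  next
    case (Suc i)
    show ?case
    proof (cases "1 \<le> j \<and> Suc i + j \<le> length p")
      case False
      then have "(Suc i, j) \<notin> gz_index (length p)" by (auto simp: mem_gz_index)
      then show ?thesis
        using a b assms(1) by (simp add: gz_entry_def lookup_outside_gz_index[OF keys_GZ])
    next
      case True
      have comb: "(1 - t) * gz_entry p a (Suc i) j + t * gz_entry p b (Suc i) j = gz_entry p u (Suc i) j"
        by (simp add: gz_entry_def ut lookup_add)
      have "gz_entry p a i j \<le> gz_entry p a (Suc i) j \<and> gz_entry p a (Suc i) j \<le> gz_entry p a i (Suc j)"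
        "gz_entry p b i j \<le> gz_entry p b (Suc i) j \<and> gz_entry p b (Suc i) j \<le> gz_entry p b i (Suc j)"
        using a b True unfolding mem_GZ by blast+
      moreover have "gz_entry p u (Suc i) j \<in> {gz_entry p u i j, gz_entry p u i (Suc j)}"
        using assms(2) True unfolding gz_tight_def by blast
      ultimately have "(gz_entry p a (Suc i) j \<ge> gz_entry p u (Suc i) j \<and>
            gz_entry p b (Suc i) j \<ge> gz_entry p u (Suc i) j) \<or>
          (gz_entry p a (Suc i) j \<le> gz_entry p u (Suc i) j \<and>
            gz_entry p b (Suc i) j \<le> gz_entry p u (Suc i) j)"
        using Suc.IH[of j] Suc.IH[of "Suc j"] by auto
      from convex_combination_at_bound[OF t this comb] show ?thesis .
    qed
  qed
  with GZ_eqI[OF a b] \<open>a \<noteq> b\<close> show False by simp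
qed (fact assms(1))

text \<open>If the entry in row \<open>i + 1\<close> lies strictly between its two upper neighbours, its value \<open>v\<close>
  does not occur in row \<open>i\<close>, so all entries equal to \<open>v\<close> in the rows below \<open>i\<close> can be moved
  together by a small amount in both directions.\<close>

lemma extreme_gz_tight:
  assumes "sorted p" "u extreme_point_of GZ p"
  shows "gz_tight p u"
  unfolding gz_tight_def
proof (intro allI impI, rule ccontr)
  fix i j
  assume ij: "1 \<le> j" "Suc i + j \<le> length p"
    and nt: "gz_entry p u (Suc i) j \<notin> {gz_entry p u i j, gz_entry p u i (Suc j)}"
  define n where "n = length p"
  define v where "v = gz_entry p u (Suc i) j"
  define S where "S = {x \<in> gz_index n. i < fst x \<and> Poly_Mapping.lookup u x = v}"
  define c :: "nat \<times> nat \<Rightarrow>\<^sub>0 real" where "c = (\<Sum>x\<in>S. Poly_Mapping.single x 1)"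
  have u: "u \<in> GZ p" using assms(2) by (simp add: extreme_point_of_def)
  have finS: "finite S" unfolding S_def using finite_gz_index by simp
  have lookup_c: "Poly_Mapping.lookup c x = (if x \<in> S then 1 else 0)" for x
    using finS by (simp add: c_def lookup_sum lookup_single when_def)
  have below: "gz_entry p u i j < v" and above: "v < gz_entry p u i (Suc j)"
    using u nt ij unfolding mem_GZ v_def by (metis insertCI order_le_less)+
  have row_mono: "gz_entry p u i a \<le> gz_entry p u i b" if "a \<le> b" "1 \<le> a" "i + b \<le> n" for a b
    using that
  proof (induction b rule: dec_induct)
    case (step b)
    then have "gz_entry p u i b \<le> gz_entry p u i (Suc b)"
      using gz_entry_row_mono[of p u b i] assms(1) u by (simp add: n_def)
    with step show ?case by simp
  qed simp
  \<comment> \<open>Row \<open>i\<close> is weakly increasing, and \<open>v\<close> lies strictly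
    between two consecutive entries of it.\<close>
  have not_v: "gz_entry p u i j' \<noteq> v" if "1 \<le> j'" "i + j' \<le> n" for j'
  proof (cases "j' \<le> j")
    case True
    then have "gz_entry p u i j' \<le> gz_entry p u i j" using row_mono that ij by (simp add: n_def)
    with below show ?thesis by simp
  next
    case False
    then have "gz_entry p u i (Suc j) \<le> gz_entry p u i j'" using row_mono that ij by simp
    with above show ?thesis by simp
  qed
  \<comment> \<open>Entries other than \<open>v\<close> keep distance at least \<epsilon> from
    \<open>v\<close>, so an entry moved from \<open>v\<close> by \<epsilon> may reach them but not
    pass them.\<close>
  have "finite ((\<lambda>(i, j). gz_entry p u i j) ` ({..n} \<times> {..n}))" by simp
  from finite_set_avoid[OF this, of v] obtain \<epsilon> where "\<epsilon> > 0"
    and "\<forall>x\<in>(\<lambda>(i, j). gz_entry p u i j) ` ({..n} \<times> {..n}). x \<noteq> v \<longrightarrow> \<epsilon> \<le> dist v x" by blast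
  then have gap: "\<epsilon> \<le> \<bar>gz_entry p u i' j' - v\<bar>"
    if "gz_entry p u i' j' \<noteq> v" "i' + j' \<le> n" for i' j'
    using that by (auto simp: dist_real_def abs_minus_commute)
  have move: "u + s *\<^sub>R c \<in> GZ p" if s: "\<bar>s\<bar> = \<epsilon>" for s
  proof -
    have entry: "gz_entry p (u + s *\<^sub>R c) i' j' =
        gz_entry p u i' j' + (if i < i' \<and> gz_entry p u i' j' = v then s else 0)"
      if "1 \<le> j'" "i' + j' \<le> n" for i' j'
      using that by (auto simp: gz_entry_def lookup_add lookup_c S_def mem_gz_index)
    \<comment> \<open>The flags \<open>A\<close> and \<open>B\<close> stand for a row lying below
      row \<open>i\<close>. Two entries equal to \<open>v\<close> move together or not at all; if
      only one equals \<open>v\<close>, the gap leaves room.\<close>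
    have comb: "x + (if A \<and> x = v then s else 0) \<le> y + (if B \<and> y = v then s else 0)"
      if "x \<le> y" "x \<noteq> v \<longrightarrow> \<epsilon> \<le> \<bar>x - v\<bar>" "y \<noteq> v \<longrightarrow> \<epsilon> \<le> \<bar>y - v\<bar>"
        "x = v \<and> y = v \<longrightarrow> A = B" for x y A B
      using that s by (auto split: if_splits)
    show ?thesis
      unfolding mem_GZ
    proof (intro conjI allI impI)
      show "Poly_Mapping.keys (u + s *\<^sub>R c) \<subseteq> gz_index (length p)"
      proof
        fix x assume "x \<in> Poly_Mapping.keys (u + s *\<^sub>R c)"
        then have "x \<in> Poly_Mapping.keys u \<or> x \<in> S"
          by (auto simp: in_keys_iff lookup_add lookup_c split: if_splits)
        then show "x \<in> gz_index (length p)"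
          using keys_GZ[OF u] by (auto simp: S_def n_def)
      qed
    next
      fix i' j' assume ij': "1 \<le> j'" "Suc i' + j' \<le> length p"
      have le: "gz_entry p u i' j' \<le> gz_entry p u (Suc i') j'"
        "gz_entry p u (Suc i') j' \<le> gz_entry p u i' (Suc j')"
        using u ij' unfolding mem_GZ by blast+
      \<comment> \<open>The flags can differ only for \<open>i' = i\<close>, and then the upper row
        contains no \<open>v\<close>.\<close>
      have same: "(i < i') = (i < Suc i')"
        if "gz_entry p u i' j' = v \<or> gz_entry p u i' (Suc j') = v"
        using not_v[of j'] not_v[of "Suc j'"] that ij' 
        by (cases "i = i'") (auto simp: n_def)
      note entries = entry[of j' i'] entry[of j' "Suc i'"] entry[of "Suc j'" i']
      note gaps = gap[of i' j'] gap[of "Suc i'" j'] gap[of i' "Suc j'"]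
      have bounds: "1 \<le> j'" "i' + j' \<le> n" "Suc i' + j' \<le> n" "1 \<le> Suc j'" "i' + Suc j' \<le> n"
        using ij' by (simp_all add: n_def)
      show "gz_entry p (u + s *\<^sub>R c) i' j' \<le> gz_entry p (u + s *\<^sub>R c) (Suc i') j'"
        unfolding entries(1)[OF bounds(1,2)] entries(2)[OF bounds(1,3)]
        using le(1) gaps bounds same by (intro comb) blast+
      show "gz_entry p (u + s *\<^sub>R c) (Suc i') j' \<le> gz_entry p (u + s *\<^sub>R c) i' (Suc j')"
        unfolding entries(2)[OF bounds(1,3)] entries(3)[OF bounds(4,5)]
        using le(2) gaps bounds same by (intro comb) blast+
    qed
  qed
  have "u + (- \<epsilon>) *\<^sub>R c \<in> GZ p" "u + \<epsilon> *\<^sub>R c \<in> GZ p"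
    using move[of "- \<epsilon>"] move[of \<epsilon>] \<open>\<epsilon> > 0\<close> by simp_all
  moreover have "u \<in> open_segment (u + (- \<epsilon>) *\<^sub>R c) (u + \<epsilon> *\<^sub>R c)"
  proof -
    have "(Suc i, j) \<in> S"
      using ij by (simp add: S_def mem_gz_index n_def v_def gz_entry_def)
    then have "Poly_Mapping.lookup (u + (- \<epsilon>) *\<^sub>R c) (Suc i, j) \<noteq>
        Poly_Mapping.lookup (u + \<epsilon> *\<^sub>R c) (Suc i, j)"
      using \<open>\<epsilon> > 0\<close> by (simp only: lookup_add lookup_scaleR lookup_c) simp
    then have "u + (- \<epsilon>) *\<^sub>R c \<noteq> u + \<epsilon> *\<^sub>R c" by metis
    moreover have "u = (1 - 1 / 2) *\<^sub>R (u + (- \<epsilon>) *\<^sub>R c) + (1 / 2) *\<^sub>R (u + \<epsilon> *\<^sub>R c)"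
      by (rule poly_mapping_eqI, simp only: lookup_add lookup_scaleR) (simp add: field_simps)
    ultimately show ?thesis
      unfolding in_segment by (intro conjI exI[of _ "1 / 2"]) simp_all
  qed
  ultimately show False
    using assms(2) unfolding extreme_point_of_def by blast
qed

lemma extreme_point_of_GZ_iff:
  assumes "sorted p"
  shows "u extreme_point_of GZ p \<longleftrightarrow> Poly_Mapping.keys u \<subseteq> gz_index (length p) \<and> gz_tight p u"
proof
  assume "u extreme_point_of GZ p"
  then show "Poly_Mapping.keys u \<subseteq> gz_index (length p) \<and> gz_tight p u"
    using extreme_gz_tight[OF assms] by (auto simp: extreme_point_of_def dest: keys_GZ)
qed (use gz_tight_mem_GZ gz_tight_extreme assms in blast)

section \<open>Recursion for the number of vertices\<close>

text \<open>Padding by 0 pins down the values outside the triangle, so that tables can be counted as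
  functions.\<close>

definition gz_row :: "int list \<Rightarrow> nat \<Rightarrow> real" where
  "gz_row p j = (if 1 \<le> j \<and> j \<le> length p then real_of_int (p ! (j - 1)) else 0)"

text \<open>Vertices as tables including row 0, so that removing row 0 maps tables to tables.\<close>

definition gz_tables :: "int list \<Rightarrow> (nat \<Rightarrow> nat \<Rightarrow> real) set" where
  "gz_tables p = {f. f 0 = gz_row p \<and>
     (\<forall>i j. if 1 \<le> j \<and> Suc i + j \<le> length p then f (Suc i) j \<in> {f i j, f i (Suc j)}
            else f (Suc i) j = 0)}"

lemma gz_tables_step:
  assumes "f \<in> gz_tables p"
  shows "if 1 \<le> j \<and> Suc i + j \<le> length p then f (Suc i) j \<in> {f i j, f i (Suc j)}
         else f (Suc i) j = 0"
  using assms unfolding gz_tables_def by blast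

text \<open>Adjoining row 0 is a bijection from vertices to tables, because below row 0 both are 0
  outside the triangle.\<close>

lemma V_eq_card_gz_tables:
  assumes "sorted p"
  shows "V p = card (gz_tables p)"
proof -
  define \<phi> :: "(nat \<times> nat \<Rightarrow>\<^sub>0 real) \<Rightarrow> nat \<Rightarrow> nat \<Rightarrow> real"
    where "\<phi> u = case_nat (gz_row p) (\<lambda>i j. Poly_Mapping.lookup u (Suc i, j))" for u
  have entry: "\<phi> u i j = gz_entry p u i j" if "1 \<le> j" "i + j \<le> length p" for u i j
    using that by (auto simp: \<phi>_def gz_entry_def gz_row_def split: nat.split)
  define A where "A = {u. Poly_Mapping.keys u \<subseteq> gz_index (length p) \<and> gz_tight p u}"
  have "inj_on \<phi> A"
  proof (rule inj_onI)
    fix a b assume ab: "a \<in> A" "b \<in> A" "\<phi> a = \<phi> b"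
    show "a = b"
    proof (rule poly_mapping_eqI)
      fix x :: "nat \<times> nat"
      obtain i j where x: "x = (i, j)" by (cases x)
      show "Poly_Mapping.lookup a x = Poly_Mapping.lookup b x"
      proof (cases i)
        case 0
        then have "x \<notin> gz_index (length p)" by (simp add: x mem_gz_index)
        with ab show ?thesis by (simp add: A_def lookup_outside_gz_index[of _ "length p"])
      next
        case (Suc i')
        then show ?thesis
          using fun_cong[OF fun_cong[OF ab(3)], of i j] by (simp add: \<phi>_def x)
      qed
    qed
  qed
  moreover have "\<phi> ` A = gz_tables p"
  proof (intro set_eqI iffI)
    fix f assume "f \<in> \<phi> ` A"
    then obtain u where u: "Poly_Mapping.keys u \<subseteq> gz_index (length p)" "gz_tight p u" "f = \<phi> u"
      by (auto simp: A_def)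
    have "f (Suc i) j = 0" if "\<not> (1 \<le> j \<and> Suc i + j \<le> length p)" for i j
    proof -
      have "(Suc i, j) \<notin> gz_index (length p)" using that by (simp add: mem_gz_index)
      then show ?thesis using u by (simp add: \<phi>_def lookup_outside_gz_index[of _ "length p"])
    qed
    moreover have "f (Suc i) j \<in> {f i j, f i (Suc j)}" if "1 \<le> j \<and> Suc i + j \<le> length p" for i j
      using that u(2) by (simp add: u(3) entry gz_tight_def)
    moreover have "f 0 = gz_row p" by (simp add: u(3) \<phi>_def)
    ultimately show "f \<in> gz_tables p" unfolding gz_tables_def by auto
  next
    fix f assume f: "f \<in> gz_tables p"
    \<comment> \<open>The inverse erases row 0, where points of the coordinate subspace are
      0.\<close>
    define u where "u = Abs_poly_mapping (\<lambda>(i, j). if i = 0 then 0 else f i j)"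
    have z: "(i, j) \<in> gz_index (length p)" if "0 < i" "f i j \<noteq> 0" for i j
      using that f by (cases i) (auto simp: gz_tables_def mem_gz_index split: if_splits)
    have "finite {x. (case x of (i, j) \<Rightarrow> if i = 0 then 0 else f i j) \<noteq> 0}"
      by (rule finite_subset[OF _ finite_gz_index[of "length p"]]) (auto split: if_splits intro: z)
    then have lookup: "Poly_Mapping.lookup u (i, j) = (if i = 0 then 0 else f i j)" for i j
      unfolding u_def by simp
    have \<phi>: "\<phi> u = f"
      using f by (auto simp: \<phi>_def lookup gz_tables_def fun_eq_iff split: nat.split)
    have "Poly_Mapping.keys u \<subseteq> gz_index (length p)"
      using z by (auto simp: in_keys_iff lookup split: if_splits)
    moreover have "gz_tight p u"
      unfolding gz_tight_def
    proof (intro allI impI)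
      fix i j assume ij: "1 \<le> j" "Suc i + j \<le> length p"
      then have "f (Suc i) j \<in> {f i j, f i (Suc j)}" using gz_tables_step[OF f, of j i] by simp
      then show "gz_entry p u (Suc i) j \<in> {gz_entry p u i j, gz_entry p u i (Suc j)}"
        using ij entry[of j "Suc i" u] entry[of j i u] entry[of "Suc j" i u] by (simp add: \<phi>)
    qed
    ultimately show "f \<in> \<phi> ` A" using \<phi> by (force simp: A_def)
  qed
  ultimately have "card A = card (gz_tables p)" by (metis card_image)
  then show ?thesis by (simp add: V_def extreme_point_of_GZ_iff[OF assms] A_def)
qed

text \<open>Being a set, it counts a choice between two equal entries once. A single entry leaves
  the empty row, whose polytope is a point.\<close>

fun next_rows :: "'a list \<Rightarrow> 'a list set" where
  "next_rows [] = {}"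
| "next_rows [x] = {[]}"
| "next_rows (x # y # xs) = (\<Union>z\<in>{x, y}. (#) z ` next_rows (y # xs))"

lemma finite_next_rows [simp]: "finite (next_rows p)"
  by (induction p rule: next_rows.induct) auto

lemma mem_next_rows:
  "p \<noteq> [] \<Longrightarrow> q \<in> next_rows p \<longleftrightarrow>
     Suc (length q) = length p \<and> (\<forall>j < length q. q ! j \<in> {p ! j, p ! Suc j})"
proof (induction p arbitrary: q rule: next_rows.induct)
  case (3 x y xs)
  show ?case
  proof (cases q)
    case (Cons z q')
    have "q \<in> next_rows (x # y # xs) \<longleftrightarrow> z \<in> {x, y} \<and> q' \<in> next_rows (y # xs)"
      by (auto simp: Cons)
    then show ?thesis
      using "3.IH" by (auto simp: Cons All_less_Suc2)
  qed auto
qed auto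

lemma sorted_next_rows:
  assumes "sorted p" "q \<in> next_rows p"
  shows "sorted q"
proof -
  have p: "p \<noteq> []" using assms(2) by auto
  note q = assms(2)[unfolded mem_next_rows[OF p]]
  show ?thesis
    unfolding sorted_iff_nth_Suc
  proof (intro allI impI)
    fix j assume j: "Suc j < length q"
    have "q ! j \<in> {p ! j, p ! Suc j}" "q ! Suc j \<in> {p ! Suc j, p ! Suc (Suc j)}"
      using q j by auto
    moreover have "p ! j \<le> p ! Suc j" "p ! Suc j \<le> p ! Suc (Suc j)"
      using assms(1) q j by (auto intro!: sorted_nth_mono)
    ultimately show "q ! j \<le> q ! Suc j" by auto
  qed
qed

text \<open>Lengths are compared separately because a genuine entry 0 looks like the
  padding.\<close>

lemma gz_row_inj:
  assumes "length p = length q" "gz_row p = gz_row q"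
  shows "p = q"
proof (rule nth_equalityI)
  fix j assume "j < length p"
  moreover have "gz_row p (Suc j) = gz_row q (Suc j)" using assms(2) by simp
  ultimately show "p ! j = q ! j" using assms(1) by (simp add: gz_row_def)
qed (fact assms(1))

text \<open>Row 1 is a choice \<open>q\<close> of second row, and the rows from 1 on form a table of
  \<open>q\<close>: as \<open>q\<close> is shorter by one, the bound on \<open>i + j\<close> shifts
  along with the rows.\<close>

lemma gz_tables_rec:
  assumes p: "p \<noteq> []"
  shows "gz_tables p = (\<Union>q\<in>next_rows p. case_nat (gz_row p) ` gz_tables q)"
proof (intro set_eqI iffI)
  fix f assume f: "f \<in> gz_tables p"
  have f0: "f 0 = gz_row p" using f by (simp add: gz_tables_def)
  note step = gz_tables_step[OF f]
  have f1: "f (Suc i) j \<in> {f i j, f i (Suc j)}" if "1 \<le> j" "Suc i + j \<le> length p" for i j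
    using step[of j i] that by simp
  have f2: "f (Suc i) j = 0" if "\<not> (1 \<le> j \<and> Suc i + j \<le> length p)" for i j
    using step[of j i] that by argo
  \<comment> \<open>Tables have real entries; since row 1 copies entries of \<open>p\<close>, it can
    be turned back into an integer list.\<close>
  have "\<exists>z. z \<in> {p ! j, p ! Suc j} \<and> f 1 (Suc j) = real_of_int z" if "Suc j < length p" for j
    using f1[of "Suc j" 0] that by (auto simp: f0 gz_row_def)
  then obtain z where z: "\<And>j. Suc j < length p \<Longrightarrow>
      z j \<in> {p ! j, p ! Suc j} \<and> f 1 (Suc j) = real_of_int (z j)"
    by metis
  define q where "q = map z [0..<length p - 1]"
  have len: "Suc (length q) = length p" using p by (simp add: q_def)
  have q: "q \<in> next_rows p"
    unfolding mem_next_rows[OF p] using z len by (auto simp: q_def)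
  have row: "f (Suc 0) = gz_row q"
  proof
    fix j show "f (Suc 0) j = gz_row q j"
    proof (cases "1 \<le> j \<and> Suc 0 + j \<le> length p")
      case True
      then show ?thesis using z[of "j - 1"] by (auto simp: gz_row_def q_def)
    next
      case False
      then show ?thesis using f2[of j 0] by (auto simp: gz_row_def len[symmetric])
    qed
  qed
  have "(\<lambda>i. f (Suc i)) \<in> gz_tables q"
    unfolding gz_tables_def using row f1[of _ "Suc _"] f2[of _ "Suc _"] len by auto
  moreover have "f = case_nat (gz_row p) (\<lambda>i. f (Suc i))"
    by (auto simp: fun_eq_iff f0 split: nat.split)
  ultimately show "f \<in> (\<Union>q\<in>next_rows p. case_nat (gz_row p) ` gz_tables q)"
    using q by blast
next
  fix f assume "f \<in> (\<Union>q\<in>next_rows p. case_nat (gz_row p) ` gz_tables q)"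
  then obtain q g where q: "q \<in> next_rows p" and g: "g \<in> gz_tables q"
    and f: "f = case_nat (gz_row p) g" by auto
  note q' = q[unfolded mem_next_rows[OF p]]
  have "if 1 \<le> j \<and> Suc i + j \<le> length p then f (Suc i) j \<in> {f i j, f i (Suc j)}
        else f (Suc i) j = 0" for i j
  proof (cases i)
    case 0
    show ?thesis
    proof (cases "1 \<le> j \<and> Suc i + j \<le> length p")
      case True
      moreover have "Suc (length q) = length p" using q' by blast
      ultimately have "j - 1 < length q" by arith
      then have "q ! (j - 1) \<in> {p ! (j - 1), p ! j}" using q' True by auto
      then show ?thesis using g True 0 q' by (auto simp: f gz_tables_def gz_row_def)
    next
      case False
      then show ?thesis using g q' 0 by (auto simp: f gz_tables_def gz_row_def)
    qed
  next
    case (Suc i')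
    have "Suc i + j \<le> length p \<longleftrightarrow> Suc i' + j \<le> length q" using q' Suc by auto
    with gz_tables_step[OF g, of j i'] show ?thesis by (auto simp: f Suc split: if_splits)
  qed
  moreover have "f 0 = gz_row p" by (simp add: f)
  ultimately show "f \<in> gz_tables p" unfolding gz_tables_def by blast
qed

lemma finite_gz_tables: "finite (gz_tables p)"
proof (induction "length p" arbitrary: p)
  case 0
  then have "gz_tables p \<subseteq> {\<lambda>i j. 0}"
    by (auto simp: gz_tables_def gz_row_def fun_eq_iff) (metis not0_implies_Suc)
  then show ?case using finite_subset by blast
next
  case (Suc n)
  then have p: "p \<noteq> []" by auto
  have "finite (gz_tables q)" if "q \<in> next_rows p" for q
    using that Suc.hyps p by (auto simp: mem_next_rows)
  then show ?case by (simp add: gz_tables_rec[OF p])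
qed

text \<open>The union in \<open>gz_tables_rec\<close> is disjoint because a table determines
  \<open>q\<close> through its row 1, and adjoining row 0 is injective.\<close>

lemma V_rec:
  assumes "sorted p" "p \<noteq> []"
  shows "V p = (\<Sum>q\<in>next_rows p. V q)"
proof -
  have inj: "inj (case_nat r :: (nat \<Rightarrow> nat \<Rightarrow> real) \<Rightarrow> _)" for r
    by (rule injI) (metis ext old.nat.simps(5))
  have "V p = card (\<Union>q\<in>next_rows p. case_nat (gz_row p) ` gz_tables q)"
    using V_eq_card_gz_tables[OF assms(1)] gz_tables_rec[OF assms(2)] by simp
  also have "\<dots> = (\<Sum>q\<in>next_rows p. card (case_nat (gz_row p) ` gz_tables q))"
  proof (rule card_UN_disjoint)
    show "\<forall>a\<in>next_rows p. \<forall>b\<in>next_rows p. a \<noteq> b \<longrightarrow>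
      case_nat (gz_row p) ` gz_tables a \<inter> case_nat (gz_row p) ` gz_tables b = {}"
    proof (intro ballI impI, rule ccontr)
      fix a b assume ab: "a \<in> next_rows p" "b \<in> next_rows p" "a \<noteq> b"
        and "case_nat (gz_row p) ` gz_tables a \<inter> case_nat (gz_row p) ` gz_tables b \<noteq> {}"
      then obtain f g where "f \<in> gz_tables a" "g \<in> gz_tables b"
        "case_nat (gz_row p) f = case_nat (gz_row p) g" by auto
      then have "f \<in> gz_tables a" "f \<in> gz_tables b"
        using injD[OF inj] by blast+
      then have "gz_row a = gz_row b"
        by (simp add: gz_tables_def)
      moreover have "length a = length b"
        using ab assms(2) by (simp add: mem_next_rows)
      ultimately show False using gz_row_inj ab by blast
    qed
  qed (simp_all add: finite_gz_tables)
  also have "\<dots> = (\<Sum>q\<in>next_rows p. V q)"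
  proof (rule sum.cong)
    fix q assume "q \<in> next_rows p"
    then show "card (case_nat (gz_row p) ` gz_tables q) = V q"
      by (simp add: V_eq_card_gz_tables sorted_next_rows[OF assms(1)]
          card_image[OF inj_on_subset[OF inj]])
  qed simp
  finally show ?thesis .
qed

section \<open>Rows below a block sequence\<close>

lemma sum_next_rows_Cons_same:
  fixes h :: "'a list \<Rightarrow> 'b::comm_monoid_add"
  shows "sum h (next_rows (x # x # xs)) = (\<Sum>q\<in>next_rows (x # xs). h (x # q))"
  by (simp add: sum.reindex)

lemma sum_next_rows_Cons_diff:
  fixes h :: "'a list \<Rightarrow> 'b::comm_monoid_add"
  assumes "x \<noteq> y"
  shows "sum h (next_rows (x # y # xs)) =
    (\<Sum>q\<in>next_rows (y # xs). h (x # q)) + (\<Sum>q\<in>next_rows (y # xs). h (y # q))"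
proof -
  have "sum h (next_rows (x # y # xs)) =
      sum h ((#) x ` next_rows (y # xs)) + sum h ((#) y ` next_rows (y # xs))"
    using assms by (auto intro!: sum.union_disjoint simp: simp del: image_insert)
  then show ?thesis by (simp add: sum.reindex)
qed

text \<open>Inside a block of equal entries there is no freedom: \<open>a + 1\<close> copies of
  \<open>x\<close> force \<open>a\<close> copies below.\<close>

lemma sum_next_rows_replicate:
  fixes h :: "'a list \<Rightarrow> 'b::comm_monoid_add"
  shows "sum h (next_rows (replicate a x @ x # xs)) =
    (\<Sum>q\<in>next_rows (x # xs). h (replicate a x @ q))"
proof (induction a arbitrary: h)
  case (Suc a)
  obtain ys where ys: "replicate a x @ x # xs = x # ys" by (cases a) auto
  have "sum h (next_rows (replicate (Suc a) x @ x # xs)) = sum h (next_rows (x # x # ys))"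
    by (simp add: ys)
  also have "\<dots> = (\<Sum>q\<in>next_rows (replicate a x @ x # xs). h (x # q))"
    by (simp only: sum_next_rows_Cons_same ys)
  finally show ?case by (simp add: Suc.IH)
qed simp

text \<open>Leaving the first block \<open>s\<close> free allows an induction that peels off blocks
  from the left.\<close>

definition blocks :: "nat \<Rightarrow> nat \<Rightarrow> (nat \<Rightarrow> nat) \<Rightarrow> int list" where
  "blocks s k i = concat (map (\<lambda>j. replicate (i j) (int j)) [s..<k + 1])"

lemma block_seq_eq_blocks: "block_seq k = blocks 1 k"
  by (simp add: fun_eq_iff block_seq_def blocks_def)

lemma blocks_Cons: "s \<le> k \<Longrightarrow> blocks s k i = replicate (i s) (int s) @ blocks (Suc s) k i"
  by (simp add: blocks_def upt_conv_Cons del: upt_Suc)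

lemma blocks_empty: "k < s \<Longrightarrow> blocks s k i = []"
  by (simp add: blocks_def)

lemma blocks_cong: "(\<And>j. s \<le> j \<Longrightarrow> j \<le> k \<Longrightarrow> i j = i' j) \<Longrightarrow> blocks s k i = blocks s k i'"
  unfolding blocks_def by (intro arg_cong[of _ _ concat] map_cong) auto

lemma sorted_blocks: "sorted (blocks s k i)"
proof -
  have "sorted (concat (map (\<lambda>j. replicate (i j) (int j)) js))" if "sorted js" for js
    using that by (induction js) (auto simp: sorted_append)
  then show ?thesis unfolding blocks_def by (metis sorted_upt)
qed

section \<open>Shift operators on coefficient families\<close>

definition shift :: "nat \<Rightarrow> mfps \<Rightarrow> mfps" where
  "shift j g = (\<lambda>m. g (m + Poly_Mapping.single j 1))"

text \<open>The counterpart, on coefficients of exponential generating functions, of a product of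
  sums of two neighbouring derivatives.\<close>

definition pair_shifts :: "nat list \<Rightarrow> mfps \<Rightarrow> mfps" where
  "pair_shifts js = op_prod (map (\<lambda>j. shift j + shift (j + 1)) js)"

lemma op_prod_simps [simp]:
  "op_prod [] g = g" "op_prod (D # Ds) g = D (op_prod Ds g)"
  by (simp_all add: op_prod_def)

lemma pair_shifts_Nil: "pair_shifts [] g = g"
  by (simp add: pair_shifts_def)

lemma pair_shifts_Cons:
  "pair_shifts (j # js) g m =
     pair_shifts js g (m + Poly_Mapping.single j 1) +
     pair_shifts js g (m + Poly_Mapping.single (Suc j) 1)"
  by (simp add: pair_shifts_def shift_def)

lemma pair_shifts_shift: "pair_shifts js g (m + e) = pair_shifts js (\<lambda>m. g (m + e)) m"
proof (induction js arbitrary: m)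
  case (Cons j js)
  have "m + e + x = m + x + e" for x :: "nat \<Rightarrow>\<^sub>0 nat" by (simp add: ac_simps)
  then show ?case by (simp only: pair_shifts_Cons Cons.IH)
qed (simp add: pair_shifts_Nil)

text \<open>Shifts with indices above \<open>s\<close> leave the exponent of \<open>s\<close> alone,
  so only exponents agreeing with \<open>m\<close> at \<open>s\<close> are ever evaluated.\<close>

lemma pair_shifts_cong:
  assumes "\<And>m'. Poly_Mapping.lookup m' s = Poly_Mapping.lookup m s \<Longrightarrow> g m' = g' m'"
    and "\<forall>j\<in>set js. s < j"
  shows "pair_shifts js g m = pair_shifts js g' m"
  using assms
proof (induction js arbitrary: m)
  case (Cons j js)
  have "Poly_Mapping.lookup (m + Poly_Mapping.single j' 1) s = Poly_Mapping.lookup m s"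
    if "j' \<in> {j, Suc j}" for j'
    using that Cons.prems(2) by (auto simp: lookup_add lookup_single_not_eq)
  then show ?case using Cons by (simp add: pair_shifts_Cons)
qed (simp add: pair_shifts_Nil)

text \<open>A block of size \<open>Suc (lookup m j)\<close> forces \<open>lookup m j\<close> copies
  of \<open>j\<close> below it, and each boundary adds one more copy of \<open>j\<close> or of
  \<open>j + 1\<close>. This choice is the factor \<open>shift j + shift (j + 1)\<close>. The
  function \<open>h\<close> is arbitrary so that the entries already fixed can be absorbed into
  it.\<close>

lemma sum_next_rows_blocks:
  assumes "s \<le> k"
  shows "sum h (next_rows (blocks s k (\<lambda>j. Suc (Poly_Mapping.lookup m j)))) =
    pair_shifts [s..<k] (\<lambda>m. h (blocks s k (Poly_Mapping.lookup m))) m"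
  using assms
proof (induction "k - s" arbitrary: s h)
  case 0
  then have "s = k" by simp
  then show ?case
    using sum_next_rows_replicate[of h "Poly_Mapping.lookup m k" "int k" "[]"]
    by (simp add: blocks_Cons blocks_empty pair_shifts_Nil replicate_append_same)
next
  case (Suc d)
  then have sk: "Suc s \<le> k" "s < k" "d = k - Suc s" by auto
  define l where "l = Poly_Mapping.lookup m"
  define e where "e j = (Poly_Mapping.single j 1 :: nat \<Rightarrow>\<^sub>0 nat)" for j
  define g where "g = (\<lambda>m. h (blocks s k (Poly_Mapping.lookup m)))"
  define B where "B = blocks (Suc s) k (\<lambda>j. Suc (l j))"
  obtain ys where ys: "B = int (Suc s) # ys"
    using sk(1) by (auto simp: B_def blocks_Cons[of "Suc s"])
  have "blocks s k (\<lambda>j. Suc (l j)) = replicate (l s) (int s) @ int s # B"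
    using sk by (simp add: B_def blocks_Cons[of s] flip: replicate_app_Cons_same)
  then have "sum h (next_rows (blocks s k (\<lambda>j. Suc (l j)))) =
      (\<Sum>q\<in>next_rows (int s # B). h (replicate (l s) (int s) @ q))"
    by (simp only: sum_next_rows_replicate)
  also have "\<dots> = (\<Sum>q\<in>next_rows B. h (replicate (l s) (int s) @ int s # q)) +
      (\<Sum>q\<in>next_rows B. h (replicate (l s) (int s) @ int (Suc s) # q))"
    unfolding ys by (rule sum_next_rows_Cons_diff) simp
  \<comment> \<open>The induction hypothesis is applied to \<open>h\<close> with a fixed prefix. The
    prefix length \<open>l s\<close> is frozen at \<open>m\<close>, whereas \<open>g\<close> reads
    it from the shifted exponent; \<open>pair_shifts_cong\<close> identifies the two.\<close>
  also have "(\<Sum>q\<in>next_rows B. h (replicate (l s) (int s) @ int s # q)) =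
      pair_shifts [Suc s..<k] (\<lambda>m. g (m + e s)) m"
    unfolding B_def l_def Suc.hyps(1)[OF sk(3,1)]
  proof (rule pair_shifts_cong[where s = s])
    fix m' assume "Poly_Mapping.lookup m' s = Poly_Mapping.lookup m s"
    moreover have "blocks (Suc s) k (Poly_Mapping.lookup (m' + e s)) =
        blocks (Suc s) k (Poly_Mapping.lookup m')"
      by (rule blocks_cong) (simp add: e_def lookup_add lookup_single_not_eq)
    ultimately show "h (replicate (Poly_Mapping.lookup m s) (int s) @ int s #
        blocks (Suc s) k (Poly_Mapping.lookup m')) = g (m' + e s)"
      using sk by (simp add: g_def blocks_Cons[of s] e_def lookup_add replicate_app_Cons_same)
  qed simp
  \<comment> \<open>Here the chosen entry joins the front of the next block and raises the exponent
    of \<open>s + 1\<close> instead.\<close>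
  also have "(\<Sum>q\<in>next_rows B. h (replicate (l s) (int s) @ int (Suc s) # q)) =
      pair_shifts [Suc s..<k] (\<lambda>m. g (m + e (Suc s))) m"
    unfolding B_def l_def Suc.hyps(1)[OF sk(3,1)]
  proof (rule pair_shifts_cong[where s = s])
    fix m' assume "Poly_Mapping.lookup m' s = Poly_Mapping.lookup m s"
    moreover have "blocks (Suc (Suc s)) k (Poly_Mapping.lookup (m' + e (Suc s))) =
        blocks (Suc (Suc s)) k (Poly_Mapping.lookup m')"
      by (rule blocks_cong) (simp add: e_def lookup_add lookup_single_not_eq)
    ultimately show "h (replicate (Poly_Mapping.lookup m s) (int s) @ int (Suc s) #
        blocks (Suc s) k (Poly_Mapping.lookup m')) = g (m' + e (Suc s))"
      using sk by (simp add: g_def blocks_Cons[of s] blocks_Cons[of "Suc s"] e_def lookup_add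
          lookup_single_not_eq)
  qed simp
  also have "pair_shifts [Suc s..<k] (\<lambda>m. g (m + e s)) m +
      pair_shifts [Suc s..<k] (\<lambda>m. g (m + e (Suc s))) m = pair_shifts [s..<k] g m"
    using sk by (simp add: upt_conv_Cons pair_shifts_Cons e_def flip: pair_shifts_shift)
  finally show ?case by (simp add: l_def g_def)
qed

section \<open>Exponential generating functions\<close>

definition egf :: "nat \<Rightarrow> mfps \<Rightarrow> mfps" where
  "egf k g = (\<lambda>m. if Poly_Mapping.keys m \<subseteq> {1..k}
     then g m / (\<Prod>j = 1..k. fact (Poly_Mapping.lookup m j)) else 0)"

lemma egf_add: "egf k (g + g') = egf k g + egf k g'"
  by (simp add: egf_def fun_eq_iff add_divide_distrib)

text \<open>The factor produced by differentiation cancels against the factorial. As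
  \<open>j\<close> lies in \<open>{1..k}\<close>, raising its exponent does not affect the support
  condition.\<close>

lemma pderiv_egf:
  assumes "j \<in> {1..k}"
  shows "pderiv_mfps j (egf k g) = egf k (shift j g)"
proof
  fix m :: "nat \<Rightarrow>\<^sub>0 nat"
  define m' where "m' = m + Poly_Mapping.single j 1"
  have l: "Poly_Mapping.lookup m' i = Poly_Mapping.lookup m i + (if i = j then 1 else 0)" for i
    by (auto simp: m'_def lookup_add lookup_single when_def)
  have "Poly_Mapping.keys m' = insert j (Poly_Mapping.keys m)"
    by (auto simp: in_keys_iff l split: if_splits)
  then have keys: "Poly_Mapping.keys m' \<subseteq> {1..k} \<longleftrightarrow> Poly_Mapping.keys m \<subseteq> {1..k}"
    using assms by auto
  have "(\<Prod>i = 1..k. fact (Poly_Mapping.lookup m' i)) =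
      (of_nat (Poly_Mapping.lookup m j + 1) :: rat) * (\<Prod>i = 1..k. fact (Poly_Mapping.lookup m i))"
    using assms by (simp add: prod.remove[of _ j] l)
  then show "pderiv_mfps j (egf k g) m = egf k (shift j g) m"
    by (simp add: pderiv_mfps_def egf_def shift_def keys flip: m'_def del: One_nat_def)
qed

lemma op_prod_egf:
  assumes "\<And>j g. j \<in> set js \<Longrightarrow> D j (egf k g) = egf k (S j g)"
  shows "op_prod (map D js) (egf k g) = egf k (op_prod (map S js) g)"
  using assms by (induction js) auto

lemma op_prod_shift: "op_prod (map shift js) g m = g (m + (\<Sum>j\<leftarrow>js. Poly_Mapping.single j 1))"
  by (induction js arbitrary: m) (simp_all add: shift_def add.assoc)

lemma lookup_sum_list_single:
  "distinct js \<Longrightarrow>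
     Poly_Mapping.lookup (\<Sum>j\<leftarrow>js. Poly_Mapping.single j 1) i = (if i \<in> set js then 1 else 0)"
  by (induction js) (auto simp: lookup_add lookup_single when_def)

theorem theorem1p1:
  fixes k :: nat
  assumes "k \<ge> 1"
  shows "(op_prod (map (\<lambda>j. pderiv_mfps j) [1..<k + 1])
          - op_prod (map (\<lambda>j. pderiv_mfps j + pderiv_mfps (j + 1)) [1..<k])) (E k) = 0"
proof -
  define g :: mfps where "g = (\<lambda>m. of_nat (V (block_seq k (Poly_Mapping.lookup m))))"
  have E: "E k = egf k g"
    by (simp add: E_def egf_def g_def)
  have "op_prod (map shift [1..<k + 1]) g m = pair_shifts [1..<k] g m" for m
  proof -
    define m' where "m' = blocks 1 k (\<lambda>j. Suc (Poly_Mapping.lookup m j))"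
    have "m' \<noteq> []" using assms by (simp add: m'_def blocks_Cons)
    have "op_prod (map shift [1..<k + 1]) g m =
        g (m + (\<Sum>j\<leftarrow>[1..<k + 1]. Poly_Mapping.single j 1))"
      by (rule op_prod_shift)
    \<comment> \<open>One shift in every variable makes all block sizes positive, the case covered
      by \<open>sum_next_rows_blocks\<close>.\<close>
    also have "\<dots> = of_nat (V m')"
      unfolding g_def block_seq_eq_blocks m'_def
      by (intro arg_cong[of _ _ "\<lambda>p. of_nat (V p)"] blocks_cong)
        (simp add: lookup_add lookup_sum_list_single del: upt_Suc One_nat_def)
    also have "\<dots> = (\<Sum>q\<in>next_rows m'. of_nat (V q))"
      using V_rec[OF _ \<open>m' \<noteq> []\<close>] by (simp add: m'_def sorted_blocks)
    also have "\<dots> = pair_shifts [1..<k] g m"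
      unfolding m'_def sum_next_rows_blocks[OF assms] g_def block_seq_eq_blocks ..
    finally show ?thesis .
  qed
  then have shifts: "op_prod (map shift [1..<k + 1]) g = pair_shifts [1..<k] g" ..
  have "op_prod (map pderiv_mfps [1..<k + 1]) (E k) = egf k (op_prod (map shift [1..<k + 1]) g)"
    unfolding E by (rule op_prod_egf) (auto intro: pderiv_egf)
  moreover have "op_prod (map (\<lambda>j. pderiv_mfps j + pderiv_mfps (j + 1)) [1..<k]) (E k) =
      egf k (pair_shifts [1..<k] g)"
    unfolding E pair_shifts_def by (rule op_prod_egf) (simp add: egf_add pderiv_egf)
  ultimately show ?thesis by (simp only: minus_apply shifts diff_self)
qed

end
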